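(* Let $R$ be a commutative ring with $1$ such that $\frac12\in R$, let $\mathcal{X}_R=\mathrm{Hom}(R,\mathbb{R})$ be nonempty, and assume the map $R\to C(\mathcal{X}_R)$, $a\mapsto\hat a$, is injective. Let $K\subseteq\mathcal{X}_R$ be a closed set and $d\ge 1$ an integer. Then $$\overline{\sum R^{2d}}^{\,\mathcal{T}_K}=\mathrm{Psd}(K).$$
   Context: $\mathcal{X}_R=\mathrm{Hom}(R,\mathbb{R})$ is the set of unitary ring homomorphisms $\alpha:R\to\mathbb{R}$, with the subspace topology inherited from the product topology on $\mathbb{R}^R$. For $a\in R$, $\hat a:\mathcal{X}_R\to\mathbb{R}$ is $\hat a(\alpha)=\alpha(a)$. $\mathcal{T}_K$ is the topology on $R$ generated by the ring-seminorms $\rho_\alpha(a)=|\alpha(a)|$, $\alpha\in K$: a neighborhood basis at $a$ is given by the sets $\{b\in R:|\alpha_i(a-b)|<\epsilon,\ i=1,\dots,m\}$ with $\epsilon>0$ and $\alpha_1,\dots,\alpha_m\in K$; equivalently it is the coarsest topology on $R$ making all $\alpha\in K$ continuous. $\sum R^{2d}$ is the set of finite sums of $2d$-th powers of elements of $R$. $\mathrm{Psd}(K):=\{a\in R:\alpha(a)\ge 0 \text{ for all }\alpha\in K\}$. The overline denotes closure in the indicated topology. *)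

theory Defs
  imports "HOL-Analysis.Analysis"
begin

definition real_homs :: "('a::comm_ring_1 \<Rightarrow> real) set" where
  "real_homs = {\<alpha>. \<alpha> 1 = 1 \<and> (\<forall>a b. \<alpha> (a + b) = \<alpha> a + \<alpha> b) \<and> (\<forall>a b. \<alpha> (a * b) = \<alpha> a * \<alpha> b)}"

definition real_homs_topology :: "('a::comm_ring_1 \<Rightarrow> real) topology" where
  "real_homs_topology = subtopology (product_topology (\<lambda>_. euclideanreal) UNIV) real_homs"

(* A function on real_homs is represented by its extension with value undefined
   elsewhere, so that equality of hat a and hat b is equality on real_homs only. *)
definition hat :: "'a::comm_ring_1 \<Rightarrow> ('a \<Rightarrow> real) \<Rightarrow> real" where
  "hat a = (\<lambda>\<alpha>\<in>real_homs. \<alpha> a)"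

definition rho :: "('a::comm_ring_1 \<Rightarrow> real) \<Rightarrow> 'a \<Rightarrow> real" where
  "rho \<alpha> a = \<bar>\<alpha> a\<bar>"

definition seminorm_nbhd :: "('a::comm_ring_1 \<Rightarrow> real) set \<Rightarrow> real \<Rightarrow> 'a \<Rightarrow> 'a set" where
  "seminorm_nbhd F \<epsilon> a = {b. \<forall>\<alpha>\<in>F. rho \<alpha> (a - b) < \<epsilon>}"

(* F = {} is allowed, so the topology is the indiscrete one on the whole ring when
   K = {}; topology_generated_by {} would instead have empty carrier. *)
definition seminorm_topology :: "('a::comm_ring_1 \<Rightarrow> real) set \<Rightarrow> 'a topology" where
  "seminorm_topology K =
     topology (\<lambda>U. \<forall>a\<in>U. \<exists>F \<epsilon>. finite F \<and> F \<subseteq> K \<and> \<epsilon> > 0 \<and> seminorm_nbhd F \<epsilon> a \<subseteq> U)"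

definition sums_of_powers :: "nat \<Rightarrow> 'a::comm_ring_1 set" where
  "sums_of_powers n = {\<Sum>i<m. f i ^ n | (m::nat) f. True}"

definition Psd :: "('a::comm_ring_1 \<Rightarrow> real) set \<Rightarrow> 'a set" where
  "Psd K = {a. \<forall>\<alpha>\<in>K. \<alpha> a \<ge> 0}"

lemma continuous_map_hat: "continuous_map real_homs_topology euclideanreal (hat a)"
proof -
  have "continuous_map real_homs_topology euclideanreal (\<lambda>\<alpha>. \<alpha> a)"
    unfolding real_homs_topology_def
    by (intro continuous_map_from_subtopology continuous_map_product_projection) simp
  then show ?thesis
    by (rule continuous_map_eq) (simp add: real_homs_topology_def hat_def)
qed

lemma istopology_seminorm:
  "istopology (\<lambda>U. \<forall>a\<in>U. \<exists>F \<epsilon>. finite F \<and> F \<subseteq> K \<and> \<epsilon> > 0 \<and> seminorm_nbhd F \<epsilon> a \<subseteq> U)"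
proof -
  define P where "P a U \<longleftrightarrow> (\<exists>F \<epsilon>. finite F \<and> F \<subseteq> K \<and> \<epsilon> > 0 \<and> seminorm_nbhd F \<epsilon> a \<subseteq> U)" for a U
  have P_Int: "P a (S \<inter> T)" if S: "P a S" and T: "P a T" for a S T
  proof -
    obtain F \<epsilon> where 1: "finite F" "F \<subseteq> K" "0 < \<epsilon>" "seminorm_nbhd F \<epsilon> a \<subseteq> S"
      using S unfolding P_def by (elim exE conjE)
    obtain G \<delta> where 2: "finite G" "G \<subseteq> K" "0 < \<delta>" "seminorm_nbhd G \<delta> a \<subseteq> T"
      using T unfolding P_def by (elim exE conjE)
    have "seminorm_nbhd (F \<union> G) (min \<epsilon> \<delta>) a \<subseteq> seminorm_nbhd F \<epsilon> a \<inter> seminorm_nbhd G \<delta> a"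
      by (auto simp: seminorm_nbhd_def)
    also have "\<dots> \<subseteq> S \<inter> T"
      using 1(4) 2(4) by (rule Int_mono)
    finally show ?thesis
      unfolding P_def using 1 2
      by (intro exI[where x = "F \<union> G"] exI[where x = "min \<epsilon> \<delta>"]) simp
  qed
  have P_mono: "P a T" if "P a S" "S \<subseteq> T" for a S T
    using that unfolding P_def by (meson order_trans)
  have "istopology (\<lambda>U. \<forall>a\<in>U. P a U)"
    unfolding istopology_def using P_Int P_mono by (meson IntE UnionE Union_upper)
  then show ?thesis
    unfolding P_def .
qed

lemma openin_seminorm_topology:
  "openin (seminorm_topology K) U \<longleftrightarrow>
     (\<forall>a\<in>U. \<exists>F \<epsilon>. finite F \<and> F \<subseteq> K \<and> \<epsilon> > 0 \<and> seminorm_nbhd F \<epsilon> a \<subseteq> U)"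
  unfolding seminorm_topology_def by (simp only: topology_inverse'[OF istopology_seminorm])

lemma topspace_seminorm_topology [simp]: "topspace (seminorm_topology K) = UNIV"
proof -
  have "openin (seminorm_topology K) UNIV"
    unfolding openin_seminorm_topology
    by (intro ballI exI[where x = "{}"] exI[where x = "1::real"]) simp
  then show ?thesis
    using openin_subset[of "seminorm_topology K" UNIV] by (simp add: top.extremum_unique)
qed

lemma openin_seminorm_nbhd:
  fixes K :: "('a::comm_ring_1 \<Rightarrow> real) set"
  assumes K: "K \<subseteq> real_homs" and F: "finite F" "F \<subseteq> K" and "\<epsilon> > 0"
  shows "openin (seminorm_topology K) (seminorm_nbhd F \<epsilon> a)"
  unfolding openin_seminorm_topology
proof
  fix b assume b: "b \<in> seminorm_nbhd F \<epsilon> a"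
  define \<delta> where "\<delta> = Min (insert \<epsilon> ((\<lambda>\<alpha>. \<epsilon> - rho \<alpha> (a - b)) ` F))"
  have "\<delta> > 0"
    unfolding \<delta>_def using F \<open>\<epsilon> > 0\<close> b by (subst Min_gr_iff) (auto simp: seminorm_nbhd_def)
  have \<delta>: "\<delta> \<le> \<epsilon> - rho \<alpha> (a - b)" if "\<alpha> \<in> F" for \<alpha>
    unfolding \<delta>_def using F that by (intro Min_le) auto
  have "seminorm_nbhd F \<delta> b \<subseteq> seminorm_nbhd F \<epsilon> a"
  proof
    fix c assume c: "c \<in> seminorm_nbhd F \<delta> b"
    have "rho \<alpha> (a - c) < \<epsilon>" if \<alpha>: "\<alpha> \<in> F" for \<alpha>
    proof -
      have add: "\<alpha> (x + y) = \<alpha> x + \<alpha> y" for x y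
        using \<alpha> F K by (auto simp: real_homs_def)
      have "\<alpha> (a - c) = \<alpha> (a - b) + \<alpha> (b - c)"
        using add[of "a - b" "b - c"] by simp
      moreover have "rho \<alpha> (b - c) < \<delta>"
        using c \<alpha> by (simp add: seminorm_nbhd_def)
      ultimately show ?thesis
        using \<delta>[OF \<alpha>] by (simp add: rho_def)
    qed
    then show "c \<in> seminorm_nbhd F \<epsilon> a"
      by (simp add: seminorm_nbhd_def)
  qed
  then show "\<exists>G \<eta>. finite G \<and> G \<subseteq> K \<and> \<eta> > 0 \<and> seminorm_nbhd G \<eta> b \<subseteq> seminorm_nbhd F \<epsilon> a"
    using F \<open>\<delta> > 0\<close> by blast
qed

end

theory Submission imports Defs begin

text \<open>
  The image of \<open>R\<close> in the finite power \<open>\<real>\<^sup>F\<close>, for finite \<open>F \<subseteq> K\<close>, is dense: its closure is a ring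
  containing the constants, because \<open>\<int>[1/2]\<close> is dense in \<open>\<real>\<close>, and it separates the points of \<open>F\<close>,
  so Lagrange interpolation applies. If \<open>a\<close> is nonnegative on \<open>F\<close>, approximating the
  \<open>2d\<close>-th roots of the numbers \<open>\<alpha> a\<close> already exhibits \<open>a\<close> as a limit of single \<open>2d\<close>-th powers.
  Conversely, evaluation at a point of \<open>K\<close> is continuous and nonnegative on even powers.
\<close>

lemma real_homs_one: "\<alpha> \<in> real_homs \<Longrightarrow> \<alpha> 1 = 1"
  and real_homs_add: "\<alpha> \<in> real_homs \<Longrightarrow> \<alpha> (a + b) = \<alpha> a + \<alpha> b"
  and real_homs_mult: "\<alpha> \<in> real_homs \<Longrightarrow> \<alpha> (a * b) = \<alpha> a * \<alpha> b"
  by (simp_all add: real_homs_def)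

lemma real_homs_zero: "\<alpha> \<in> real_homs \<Longrightarrow> \<alpha> 0 = 0"
  using real_homs_add[of \<alpha> 0 0] by simp

lemma real_homs_uminus: "\<alpha> \<in> real_homs \<Longrightarrow> \<alpha> (- a) = - \<alpha> a"
  using real_homs_add[of \<alpha> a "- a"] by (simp add: real_homs_zero)

lemma real_homs_diff: "\<alpha> \<in> real_homs \<Longrightarrow> \<alpha> (a - b) = \<alpha> a - \<alpha> b"
  using real_homs_add[of \<alpha> a "- b"] by (simp add: real_homs_uminus)

lemma real_homs_power: "\<alpha> \<in> real_homs \<Longrightarrow> \<alpha> (a ^ n) = \<alpha> a ^ n"
  by (induction n) (simp_all add: real_homs_one real_homs_mult)

lemma real_homs_sum: "\<alpha> \<in> real_homs \<Longrightarrow> \<alpha> (\<Sum>i\<in>A. f i) = (\<Sum>i\<in>A. \<alpha> (f i))"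
  by (induction A rule: infinite_finite_induct) (simp_all add: real_homs_zero real_homs_add)

lemma real_homs_of_nat: "\<alpha> \<in> real_homs \<Longrightarrow> \<alpha> (of_nat n) = of_nat n"
  by (induction n) (simp_all add: real_homs_zero real_homs_one real_homs_add)

lemma real_homs_of_int: "\<alpha> \<in> real_homs \<Longrightarrow> \<alpha> (of_int n) = of_int n"
  by (cases n rule: int_cases2) (simp_all add: real_homs_of_nat real_homs_uminus)

text \<open>This encodes the closure of the image of the ring in the product of copies of the reals
  indexed by \<open>F\<close>. For finite \<open>F\<close> that product is metrizable, so sequences
  suffice. A single sequence \<open>r\<close> must serve all points of \<open>F\<close> at once;
  values of \<open>v\<close> off \<open>F\<close> are irrelevant.\<close>

definition pointwise_limits :: "('a::comm_ring_1 \<Rightarrow> real) set \<Rightarrow> (('a \<Rightarrow> real) \<Rightarrow> real) set" where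
  "pointwise_limits F = {v. \<exists>r. \<forall>\<alpha>\<in>F. (\<lambda>n. \<alpha> (r n)) \<longlonglongrightarrow> v \<alpha>}"

lemma pointwise_limits_eval: "(\<lambda>\<alpha>. \<alpha> a) \<in> pointwise_limits F"
  unfolding pointwise_limits_def by (intro CollectI exI[of _ "\<lambda>_. a"]) simp

text \<open>Approximating sequences can be added termwise because each \<alpha> is additive;
  products work in the same way below, so the limits are closed under both ring operations.\<close>

lemma pointwise_limits_add:
  assumes "F \<subseteq> real_homs" "u \<in> pointwise_limits F" "v \<in> pointwise_limits F"
  shows "(\<lambda>\<alpha>. u \<alpha> + v \<alpha>) \<in> pointwise_limits F"
proof -
  obtain r s where "\<And>\<alpha>. \<alpha> \<in> F \<Longrightarrow> (\<lambda>n. \<alpha> (r n)) \<longlonglongrightarrow> u \<alpha>" "\<And>\<alpha>. \<alpha> \<in> F \<Longrightarrow> (\<lambda>n. \<alpha> (s n)) \<longlonglongrightarrow> v \<alpha>"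
    using assms(2,3) unfolding pointwise_limits_def by blast
  then have "(\<lambda>n. \<alpha> (r n + s n)) \<longlonglongrightarrow> u \<alpha> + v \<alpha>" if "\<alpha> \<in> F" for \<alpha>
    using that assms(1) by (simp add: real_homs_add subset_iff tendsto_add)
  then show ?thesis
    unfolding pointwise_limits_def by (intro CollectI exI[of _ "\<lambda>n. r n + s n"]) blast
qed

lemma pointwise_limits_mult:
  assumes "F \<subseteq> real_homs" "u \<in> pointwise_limits F" "v \<in> pointwise_limits F"
  shows "(\<lambda>\<alpha>. u \<alpha> * v \<alpha>) \<in> pointwise_limits F"
proof -
  obtain r s where "\<And>\<alpha>. \<alpha> \<in> F \<Longrightarrow> (\<lambda>n. \<alpha> (r n)) \<longlonglongrightarrow> u \<alpha>" "\<And>\<alpha>. \<alpha> \<in> F \<Longrightarrow> (\<lambda>n. \<alpha> (s n)) \<longlonglongrightarrow> v \<alpha>"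
    using assms(2,3) unfolding pointwise_limits_def by blast
  then have "(\<lambda>n. \<alpha> (r n * s n)) \<longlonglongrightarrow> u \<alpha> * v \<alpha>" if "\<alpha> \<in> F" for \<alpha>
    using that assms(1) by (simp add: real_homs_mult subset_iff tendsto_mult)
  then show ?thesis
    unfolding pointwise_limits_def by (intro CollectI exI[of _ "\<lambda>n. r n * s n"]) blast
qed

text \<open>Rounding down loses less than 1 before the division, hence less than
  \<open>(1/2) ^ n\<close> after it. Dyadic approximations are chosen because they lift to any ring
  in which 2 is invertible.\<close>

lemma dyadic_floor_tendsto: "(\<lambda>n. of_int \<lfloor>c * 2 ^ n\<rfloor> / 2 ^ n) \<longlonglongrightarrow> (c::real)"
proof (rule real_tendsto_sandwich)
  have "c - (1/2) ^ n \<le> of_int \<lfloor>c * 2 ^ n\<rfloor> / 2 ^ n" for n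
  proof -
    have "c - (1/2) ^ n = (c * 2 ^ n - 1) / 2 ^ n"
      by (simp add: power_one_over diff_divide_distrib)
    also have "\<dots> \<le> of_int \<lfloor>c * 2 ^ n\<rfloor> / 2 ^ n"
      by (intro divide_right_mono) (linarith, simp)
    finally show ?thesis .
  qed
  then show "\<forall>\<^sub>F n in sequentially. c - (1/2) ^ n \<le> of_int \<lfloor>c * 2 ^ n\<rfloor> / 2 ^ n"
    by (intro always_eventually allI)
  show "\<forall>\<^sub>F n in sequentially. of_int \<lfloor>c * 2 ^ n\<rfloor> / 2 ^ n \<le> c"
    by (intro always_eventually allI) (simp add: field_simps)
  have "(\<lambda>n. c - (1/2) ^ n) \<longlonglongrightarrow> c - 0"
    by (intro tendsto_diff tendsto_const LIMSEQ_power_zero) simp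
  then show "(\<lambda>n. c - (1/2) ^ n) \<longlonglongrightarrow> c"
    by simp
qed simp

text \<open>Every homomorphism sends the inverse \<open>h\<close> of 2 to 1/2, so a dyadic
  expression in \<open>h\<close> has the same image at all points of \<open>F\<close>, namely the
  dyadic approximation of \<open>c\<close>.\<close>

lemma pointwise_limits_const:
  fixes F :: "('a::comm_ring_1 \<Rightarrow> real) set"
  assumes "F \<subseteq> real_homs" "(2::'a) dvd 1"
  shows "(\<lambda>_. c) \<in> pointwise_limits F"
proof -
  obtain h :: 'a where h: "1 = 2 * h"
    using assms(2) by (rule dvdE)
  have "(\<lambda>n. \<alpha> (of_int \<lfloor>c * 2 ^ n\<rfloor> * h ^ n)) \<longlonglongrightarrow> c" if "\<alpha> \<in> F" for \<alpha>
  proof -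
    have \<alpha>: "\<alpha> \<in> real_homs"
      using that assms(1) by blast
    have "1 = 2 * \<alpha> h"
      using real_homs_mult[OF \<alpha>, of 2 h] real_homs_of_int[OF \<alpha>, of 2]
      by (simp add: real_homs_one[OF \<alpha>] flip: h)
    then have half: "\<alpha> h = 1 / 2"
      by simp
    show ?thesis
      using dyadic_floor_tendsto[of c]
      by (simp add: real_homs_mult[OF \<alpha>] real_homs_of_int[OF \<alpha>] real_homs_power[OF \<alpha>]
          half power_one_over)
  qed
  then show ?thesis
    unfolding pointwise_limits_def
    by (intro CollectI exI[of _ "\<lambda>n. of_int \<lfloor>c * 2 ^ n\<rfloor> * h ^ n"]) blast
qed

lemma pointwise_limits_sum:
  fixes F :: "('a::comm_ring_1 \<Rightarrow> real) set"
  assumes "F \<subseteq> real_homs" "(2::'a) dvd 1" "\<And>i. i \<in> A \<Longrightarrow> u i \<in> pointwise_limits F"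
  shows "(\<lambda>\<alpha>. \<Sum>i\<in>A. u i \<alpha>) \<in> pointwise_limits F"
  using assms(3)
  by (induction A rule: infinite_finite_induct)
    (simp_all add: pointwise_limits_const[OF assms(1,2)] pointwise_limits_add[OF assms(1)])

lemma pointwise_limits_prod:
  fixes F :: "('a::comm_ring_1 \<Rightarrow> real) set"
  assumes "F \<subseteq> real_homs" "(2::'a) dvd 1" "\<And>i. i \<in> A \<Longrightarrow> u i \<in> pointwise_limits F"
  shows "(\<lambda>\<alpha>. \<Prod>i\<in>A. u i \<alpha>) \<in> pointwise_limits F"
  using assms(3)
  by (induction A rule: infinite_finite_induct)
    (simp_all add: pointwise_limits_const[OF assms(1,2)] pointwise_limits_mult[OF assms(1)])

lemma pointwise_limits_cong:
  assumes "u \<in> pointwise_limits F" "\<And>\<alpha>. \<alpha> \<in> F \<Longrightarrow> u \<alpha> = v \<alpha>"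
  shows "v \<in> pointwise_limits F"
  using assms by (auto simp: pointwise_limits_def)

lemma pointwise_limits_eq_UNIV:
  fixes F :: "('a::comm_ring_1 \<Rightarrow> real) set"
  assumes F: "F \<subseteq> real_homs" "finite F" and 2: "(2::'a) dvd 1"
  shows "pointwise_limits F = UNIV"
proof (intro set_eqI iffI UNIV_I)
  fix v :: "('a \<Rightarrow> real) \<Rightarrow> real"
  \<comment> \<open>The element \<open>x \<beta> \<gamma>\<close> acts as a coordinate separating
    two distinct points; it is arbitrary when they coincide.\<close>
  define x where "x \<beta> \<gamma> = (SOME a. \<beta> a \<noteq> \<gamma> a)" for \<beta> \<gamma> :: "'a \<Rightarrow> real"
  have x: "\<beta> (x \<beta> \<gamma>) \<noteq> \<gamma> (x \<beta> \<gamma>)" if "\<beta> \<noteq> \<gamma>" for \<beta> \<gamma>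
    unfolding x_def by (rule someI_ex) (use that in blast)
  \<comment> \<open>A Lagrange factor: for distinct \<beta> and \<gamma> it is 1 at \<beta> and 0 at
    \<gamma>. Writing it with \<open>+ -\<close> and \<open>inverse\<close> matches the closure
    lemmas; since \<open>inverse 0 = 0\<close>, it is also defined for equal points.\<close>
  define l where "l \<beta> \<gamma> \<alpha> = (\<alpha> (x \<beta> \<gamma>) + - \<gamma> (x \<beta> \<gamma>)) * inverse (\<beta> (x \<beta> \<gamma>) - \<gamma> (x \<beta> \<gamma>))"
    for \<alpha> \<beta> \<gamma>
  have l: "l \<beta> \<gamma> \<in> pointwise_limits F" for \<beta> \<gamma>
    unfolding l_def
    by (intro pointwise_limits_mult pointwise_limits_add pointwise_limits_const
        pointwise_limits_eval F(1) 2)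
  \<comment> \<open>The Lagrange interpolant of \<open>v\<close> on \<open>F\<close>: each product
    is 1 at its own \<beta> and 0 at the other points of \<open>F\<close>.\<close>
  define u where "u \<alpha> = (\<Sum>\<beta>\<in>F. v \<beta> * (\<Prod>\<gamma>\<in>F - {\<beta>}. l \<beta> \<gamma> \<alpha>))" for \<alpha>
  have "u \<in> pointwise_limits F"
    unfolding u_def
    by (intro pointwise_limits_sum pointwise_limits_mult pointwise_limits_prod
        pointwise_limits_const F(1) 2 l)
  moreover have "u \<alpha> = v \<alpha>" if \<alpha>: "\<alpha> \<in> F" for \<alpha>
  proof -
    have "(\<Prod>\<gamma>\<in>F - {\<beta>}. l \<beta> \<gamma> \<alpha>) = (if \<beta> = \<alpha> then 1 else 0)" if "\<beta> \<in> F" for \<beta>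
    proof (cases "\<beta> = \<alpha>")
      case True
      have "l \<alpha> \<gamma> \<alpha> = 1" if "\<gamma> \<noteq> \<alpha>" for \<gamma>
        using x[of \<alpha> \<gamma>] that by (auto simp: l_def)
      with True show ?thesis
        by (auto intro!: prod.neutral)
    next
      case False
      \<comment> \<open>The factor indexed by \<alpha> occurs in the product for \<beta> and makes
        it vanish at \<alpha>.\<close>
      have "l \<beta> \<alpha> \<alpha> = 0"
        by (simp add: l_def)
      with False \<alpha> F(2) show ?thesis
        by (auto intro!: prod_zero bexI[of _ \<alpha>])
    qed
    then have "u \<alpha> = (\<Sum>\<beta>\<in>F. if \<beta> = \<alpha> then v \<beta> else 0)"
      unfolding u_def by (intro sum.cong) auto
    with \<alpha> F(2) show ?thesis
      by simp
  qed
  ultimately show "v \<in> pointwise_limits F"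
    by (rule pointwise_limits_cong)
qed

lemma power_in_sums_of_powers: "r ^ n \<in> sums_of_powers n"
  unfolding sums_of_powers_def by (intro CollectI exI[of _ "1::nat"] exI[of _ "\<lambda>_. r"]) simp

lemma real_homs_nonneg_sums_of_powers:
  assumes "\<alpha> \<in> real_homs" "s \<in> sums_of_powers (2 * d)"
  shows "\<alpha> s \<ge> 0"
  using assms
  by (auto simp: sums_of_powers_def real_homs_sum real_homs_power power_mult intro!: sum_nonneg)

text \<open>The roots of the values of \<open>a\<close> on \<open>F\<close> form a pointwise limit
  of ring elements, and taking powers is continuous. Nonnegativity of these values ensures that the
  power undoes the root, for odd and even \<open>n\<close> alike.\<close>

lemma power_in_seminorm_nbhd:
  fixes F :: "('a::comm_ring_1 \<Rightarrow> real) set"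
  assumes F: "F \<subseteq> real_homs" "finite F" and 2: "(2::'a) dvd 1" and "n \<ge> 1" "\<epsilon> > 0"
    and a: "\<And>\<alpha>. \<alpha> \<in> F \<Longrightarrow> \<alpha> a \<ge> 0"
  obtains r where "r ^ n \<in> seminorm_nbhd F \<epsilon> a"
proof -
  have "(\<lambda>\<alpha>. root n (\<alpha> a)) \<in> pointwise_limits F"
    by (simp add: pointwise_limits_eq_UNIV[OF F 2])
  then obtain r where r: "\<And>\<alpha>. \<alpha> \<in> F \<Longrightarrow> (\<lambda>k. \<alpha> (r k)) \<longlonglongrightarrow> root n (\<alpha> a)"
    by (auto simp: pointwise_limits_def)
  have "\<forall>\<^sub>F k in sequentially. rho \<alpha> (a - r k ^ n) < \<epsilon>" if \<alpha>: "\<alpha> \<in> F" for \<alpha>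
  proof -
    have hom: "\<alpha> \<in> real_homs"
      using \<alpha> F(1) by blast
    have "(\<lambda>k. \<alpha> (r k) ^ n) \<longlonglongrightarrow> \<alpha> a"
      using tendsto_power[OF r[OF \<alpha>], of n] a[OF \<alpha>] \<open>n \<ge> 1\<close> by simp
    then have "\<forall>\<^sub>F k in sequentially. dist (\<alpha> (r k) ^ n) (\<alpha> a) < \<epsilon>"
      using \<open>\<epsilon> > 0\<close> by (rule tendstoD)
    then show ?thesis
      by (simp add: rho_def real_homs_diff[OF hom] real_homs_power[OF hom] dist_real_def
          abs_minus_commute)
  qed
  \<comment> \<open>Finiteness of \<open>F\<close> allows one index to work for all its
    points.\<close>
  then have "\<forall>\<^sub>F k in sequentially. \<forall>\<alpha>\<in>F. rho \<alpha> (a - r k ^ n) < \<epsilon>"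
    using F(2) by (simp add: eventually_ball_finite_distrib)
  then obtain k where "\<forall>\<alpha>\<in>F. rho \<alpha> (a - r k ^ n) < \<epsilon>"
    by (auto dest: eventually_happens)
  then show thesis
    by (intro that[of "r k"]) (simp add: seminorm_nbhd_def)
qed

theorem theorem4p5:
  fixes K :: "('a::comm_ring_1 \<Rightarrow> real) set" and d :: nat
  assumes "(2::'a) dvd 1"
    and "(real_homs :: ('a \<Rightarrow> real) set) \<noteq> {}"
    and "inj (hat :: 'a \<Rightarrow> ('a \<Rightarrow> real) \<Rightarrow> real)"
    and "closedin real_homs_topology K"
    and "d \<ge> 1"
  shows "seminorm_topology K closure_of sums_of_powers (2 * d) = Psd K"
proof (intro set_eqI iffI)
  have K: "K \<subseteq> real_homs"
    using closedin_subset[OF assms(4)] by (simp add: real_homs_topology_def)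
  fix a :: 'a
  {
    assume a: "a \<in> seminorm_topology K closure_of sums_of_powers (2 * d)"
    have "\<alpha> a \<ge> 0" if \<alpha>: "\<alpha> \<in> K" for \<alpha>
    proof (rule ccontr)
      assume neg: "\<not> \<alpha> a \<ge> 0"
      have hom: "\<alpha> \<in> real_homs"
        using \<alpha> K by blast
      \<comment> \<open>With radius \<open>- \<alpha> a\<close>, the neighborhood contains only
        elements on which \<alpha> is negative, hence no sum of even powers.\<close>
      have "openin (seminorm_topology K) (seminorm_nbhd {\<alpha>} (- \<alpha> a) a)"
        using K \<alpha> neg by (intro openin_seminorm_nbhd) auto
      moreover have "a \<in> seminorm_nbhd {\<alpha>} (- \<alpha> a) a"
        using neg by (simp add: seminorm_nbhd_def rho_def real_homs_zero[OF hom])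
      ultimately obtain s where "s \<in> sums_of_powers (2 * d)" "s \<in> seminorm_nbhd {\<alpha>} (- \<alpha> a) a"
        using a by (auto simp: in_closure_of)
      then show False
        using real_homs_nonneg_sums_of_powers[OF hom] neg
        by (force simp: seminorm_nbhd_def rho_def real_homs_diff[OF hom])
    qed
    then show "a \<in> Psd K"
      by (simp add: Psd_def)
  next
    assume a: "a \<in> Psd K"
    have "\<exists>s\<in>sums_of_powers (2 * d). s \<in> U" if U: "openin (seminorm_topology K) U" "a \<in> U" for U
    proof -
      obtain F \<epsilon> where F: "finite F" "F \<subseteq> K" "\<epsilon> > 0" "seminorm_nbhd F \<epsilon> a \<subseteq> U"
        using U by (auto simp: openin_seminorm_topology)
      \<comment> \<open>A basic neighborhood tests only finitely many points of \<open>K\<close>, so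
        one power already meets it. The bound on \<open>2 * d\<close> excludes
        \<open>root 0\<close>, which is constantly 0.\<close>
      have "F \<subseteq> real_homs" "2 * d \<ge> 1" "\<And>\<alpha>. \<alpha> \<in> F \<Longrightarrow> \<alpha> a \<ge> 0"
        using F(2) K a assms(5) by (auto simp: Psd_def)
      then obtain r where "r ^ (2 * d) \<in> seminorm_nbhd F \<epsilon> a"
        using F(1,3) assms(1) by (metis power_in_seminorm_nbhd)
      then show ?thesis
        using F(4) power_in_sums_of_powers by blast
    qed
    then show "a \<in> seminorm_topology K closure_of sums_of_powers (2 * d)"
      by (auto simp: in_closure_of)
  }
qed

end
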